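(* Let $\mathcal T$ be a $\mathfrak G$-symmetric poset with a $\mathfrak G$-compatible generating subposet $\mathcal Z$, and let $\lambda:\mathcal Z\to\Sigma(\Phi)$ be the associated $\mathfrak G$-stabilizer-preserving map. Let $\mathfrak G\mathcal Z^\lambda$ be the poset whose underlying set is $\{(z,g\lambda(z)):\ z\in\mathcal Z,\ g\in\mathfrak G\}$ (a set of pairs), ordered by $(z_1,\eta_1)\le(z_2,\eta_2)$ if and only if $z_1\le_{\mathcal Z}z_2$ and there exists $g\in\mathfrak G$ with $g^{-1}\eta_1=\lambda(z_1)$ and $g^{-1}\eta_2=\lambda(z_2)$. Then $\mathfrak G\mathcal Z^\lambda$ is isomorphic to $\mathcal T$ as a poset.
   Context: $W$ is a finite-dimensional real inner product space, $\mathcal H$ a finite set of linear hyperplanes in $W$ meeting in a single point such that the group $\mathfrak G\subseteq GL(W)$ generated by the reflections in them is finite; $\Phi$ is a fixed chamber (maximal cone) of the fan induced by $\mathcal H$ and $\Sigma(\Phi)$ is the set of nonempty faces of $\Phi$. For $\phi\in\Sigma(\Phi)$, $\mathfrak G_\phi=\{g\in\mathfrak G: g\phi=\phi\}$; distinct faces of $\Phi$ have distinct stabilizers. A $\mathfrak G$-symmetric poset is a poset $\mathcal T$ with a (left) action of $\mathfrak G$ on its elements preserving the partial order. An induced subposet $\mathcal Z$ of $\mathcal T$ is a generating subposet if (1) $\mathcal T=\bigsqcup_{z\in\mathcal Z}\mathfrak G\cdot z$ as a disjoint union of orbits, and (2) whenever $t_i=g_iz_i$ with $g_i\in\mathfrak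 G$, $z_i\in\mathcal Z$ ($i=1,2$), we have $t_1\le t_2$ iff $z_1\le z_2$ and there exists $g\in\mathfrak G$ with $t_i=gz_i$ for $i=1,2$. $\mathcal Z$ is $\mathfrak G$-compatible if for every $z\in\mathcal Z$ there is $\phi\in\Sigma(\Phi)$ with $\mathfrak G_z=\mathfrak G_\phi$ (where $\mathfrak G_z$ is the stabilizer of $z$); this $\phi$ is unique and the associated $\mathfrak G$-stabilizer-preserving map is $\lambda(z)=\phi$. *)

theory Defs
  imports
    "HOL-Analysis.Polytope"
    "HOL-Algebra.Group_Action"
    "HOL-Algebra.Generated_Groups"
    "HOL-Library.Disjoint_Sets"
begin

definition hyperplane_normals :: "'w::real_inner set set \<Rightarrow> 'w set" where
  "hyperplane_normals H = {a. a \<noteq> 0 \<and> {x. a \<bullet> x = 0} \<in> H}"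

definition linear_hyperplane :: "'w::real_inner set \<Rightarrow> bool" where
  "linear_hyperplane h \<longleftrightarrow> (\<exists>a. a \<noteq> 0 \<and> h = {x. a \<bullet> x = 0})"

definition reflection :: "'w::real_inner \<Rightarrow> 'w \<Rightarrow> 'w" where
  "reflection a x = x - (2 * (a \<bullet> x) / (a \<bullet> a)) *\<^sub>R a"

definition GL :: "('w::real_vector \<Rightarrow> 'w) monoid" where
  "GL = \<lparr>carrier = {f. linear f \<and> bij f}, mult = (\<circ>), one = id\<rparr>"

definition reflection_group :: "'w::real_inner set set \<Rightarrow> ('w \<Rightarrow> 'w) monoid" where
  "reflection_group H = GL\<lparr>carrier := generate GL (reflection ` hyperplane_normals H)\<rparr>"

text \<open>The set of points lying on the same side of (or on) each hyperplane as \<open>x\<close>;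
  it does not depend on the scaling of the normals, so all of them may be used.
  The closures of these cells are the cones of the fan.\<close>

definition arrangement_cell :: "'w::real_inner set set \<Rightarrow> 'w \<Rightarrow> 'w set" where
  "arrangement_cell H x = {y. \<forall>a\<in>hyperplane_normals H. sgn (a \<bullet> y) = sgn (a \<bullet> x)}"

definition arrangement_fan :: "'w::real_inner set set \<Rightarrow> 'w set set" where
  "arrangement_fan H = {closure (arrangement_cell H x) | x. True}"

definition chamber :: "'w::real_inner set set \<Rightarrow> 'w set \<Rightarrow> bool" where
  "chamber H \<Phi> \<longleftrightarrow> \<Phi> \<in> arrangement_fan H \<and> (\<forall>C\<in>arrangement_fan H. \<Phi> \<subseteq> C \<longrightarrow> C = \<Phi>)"

definition nonempty_faces :: "'w::real_vector set \<Rightarrow> 'w set set" where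
  "nonempty_faces \<Phi> = {F. F face_of \<Phi> \<and> F \<noteq> {}}"

definition symmetric_poset ::
  "('g, 'x) monoid_scheme \<Rightarrow> 't set \<Rightarrow> ('t \<times> 't) set \<Rightarrow> ('g \<Rightarrow> 't \<Rightarrow> 't) \<Rightarrow> bool" where
  "symmetric_poset G T r \<alpha> \<longleftrightarrow>
     partial_order_on T r \<and> group_action G T \<alpha> \<and>
     (\<forall>g\<in>carrier G. \<forall>x\<in>T. \<forall>y\<in>T. (x, y) \<in> r \<longrightarrow> (\<alpha> g x, \<alpha> g y) \<in> r)"

definition generating_subposet ::
  "('g, 'x) monoid_scheme \<Rightarrow> 't set \<Rightarrow> ('t \<times> 't) set \<Rightarrow> ('g \<Rightarrow> 't \<Rightarrow> 't) \<Rightarrow> 't set \<Rightarrow> bool" where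
  "generating_subposet G T r \<alpha> Z \<longleftrightarrow>
     Z \<subseteq> T \<and>
     T = (\<Union>z\<in>Z. orbit G \<alpha> z) \<and> disjoint_family_on (orbit G \<alpha>) Z \<and>
     (\<forall>t1 t2. \<forall>g1\<in>carrier G. \<forall>g2\<in>carrier G. \<forall>z1\<in>Z. \<forall>z2\<in>Z.
        t1 = \<alpha> g1 z1 \<and> t2 = \<alpha> g2 z2 \<longrightarrow>
        ((t1, t2) \<in> r \<longleftrightarrow>
          (z1, z2) \<in> r \<and> (\<exists>g\<in>carrier G. t1 = \<alpha> g z1 \<and> t2 = \<alpha> g z2)))"

text \<open>Here \<open>G\<close> consists of maps \<open>'w \<Rightarrow> 'w\<close>; it acts on subsets of \<open>'w\<close> by taking images.\<close>

definition compatible ::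
  "('w::real_vector \<Rightarrow> 'w, 'x) monoid_scheme \<Rightarrow> 'w set \<Rightarrow> (('w \<Rightarrow> 'w) \<Rightarrow> 't \<Rightarrow> 't) \<Rightarrow> 't set \<Rightarrow> bool"
where
  "compatible G \<Phi> \<alpha> Z \<longleftrightarrow>
     (\<forall>z\<in>Z. \<exists>\<phi>\<in>nonempty_faces \<Phi>. stabilizer G \<alpha> z = stabilizer G image \<phi>)"

definition stabilizer_preserving ::
  "('w::real_vector \<Rightarrow> 'w, 'x) monoid_scheme \<Rightarrow> 'w set \<Rightarrow> (('w \<Rightarrow> 'w) \<Rightarrow> 't \<Rightarrow> 't) \<Rightarrow> 't set
     \<Rightarrow> ('t \<Rightarrow> 'w set) \<Rightarrow> bool" where
  "stabilizer_preserving G \<Phi> \<alpha> Z lam \<longleftrightarrow>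
     (\<forall>z\<in>Z. lam z \<in> nonempty_faces \<Phi> \<and> stabilizer G \<alpha> z = stabilizer G image (lam z))"

definition face_poset_carrier ::
  "('w \<Rightarrow> 'w, 'x) monoid_scheme \<Rightarrow> 't set \<Rightarrow> ('t \<Rightarrow> 'w set) \<Rightarrow> ('t \<times> 'w set) set" where
  "face_poset_carrier G Z lam = {(z, g ` lam z) | z g. z \<in> Z \<and> g \<in> carrier G}"

definition face_poset_order ::
  "('w \<Rightarrow> 'w, 'x) monoid_scheme \<Rightarrow> ('t \<times> 't) set \<Rightarrow> 't set \<Rightarrow> ('t \<Rightarrow> 'w set)
     \<Rightarrow> (('t \<times> 'w set) \<times> ('t \<times> 'w set)) set" where
  "face_poset_order G r Z lam =
     {((z1, \<eta>1), (z2, \<eta>2)) | z1 \<eta>1 z2 \<eta>2.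
        (z1, \<eta>1) \<in> face_poset_carrier G Z lam \<and> (z2, \<eta>2) \<in> face_poset_carrier G Z lam \<and>
        (z1, z2) \<in> r \<and>
        (\<exists>g\<in>carrier G. (inv\<^bsub>G\<^esub> g) ` \<eta>1 = lam z1 \<and> (inv\<^bsub>G\<^esub> g) ` \<eta>2 = lam z2)}"

definition poset_isomorphic ::
  "'a set \<Rightarrow> ('a \<times> 'a) set \<Rightarrow> 'b set \<Rightarrow> ('b \<times> 'b) set \<Rightarrow> bool" where
  "poset_isomorphic A r B s \<longleftrightarrow>
     partial_order_on A r \<and> partial_order_on B s \<and>
     (\<exists>f. bij_betw f A B \<and> (\<forall>x\<in>A. \<forall>y\<in>A. (x, y) \<in> r \<longleftrightarrow> (f x, f y) \<in> s))"

end

theory Submission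
  imports Defs
begin

text \<open>The isomorphism sends \<open>(z, g \<phi>)\<close>, where \<open>\<phi> = \<lambda>(z)\<close>, to \<open>g z\<close>. Since \<open>z\<close> and \<open>\<phi>\<close> have the same
  stabilizer, \<open>g \<phi> = h \<phi>\<close> if and only if \<open>g z = h z\<close>, which gives well-definedness and injectivity,
  and turns the order of pairs into condition (2) of a generating subposet.\<close>

text \<open>Apply \<open>inv h\<close> to both sides of the equation. The point is that whether two
  group elements agree at \<open>x\<close> depends on the stabilizer of \<open>x\<close>
  alone.\<close>

lemma (in group_action) action_eq_iff_stabilizer:
  assumes "g \<in> carrier G" "h \<in> carrier G" "x \<in> E"
  shows "\<phi> g x = \<phi> h x \<longleftrightarrow> inv\<^bsub>G\<^esub> h \<otimes>\<^bsub>G\<^esub> g \<in> stabilizer G \<phi> x"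
proof -
  interpret group G using group_hom group_hom.axioms(1) by blast
  have gx: "\<phi> g x \<in> E" using assms element_image by blast
  have comp: "\<phi> (inv\<^bsub>G\<^esub> h \<otimes>\<^bsub>G\<^esub> g) x = \<phi> (inv\<^bsub>G\<^esub> h) (\<phi> g x)"
    using assms composition_rule by blast
  have "\<phi> (inv\<^bsub>G\<^esub> h) (\<phi> g x) = x \<longleftrightarrow> \<phi> g x = \<phi> h x"
  proof
    assume "\<phi> (inv\<^bsub>G\<^esub> h) (\<phi> g x) = x"
    then show "\<phi> g x = \<phi> h x"
      using orbit_sym_aux[of "inv\<^bsub>G\<^esub> h" "\<phi> g x" x] gx assms by simp
  next
    assume "\<phi> g x = \<phi> h x"
    then show "\<phi> (inv\<^bsub>G\<^esub> h) (\<phi> g x) = x"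
      using orbit_sym_aux[of h x "\<phi> h x"] assms by simp
  qed
  then show ?thesis using assms comp by (simp add: stabilizer_def)
qed

text \<open>Both equations say that the product of \<open>inv h\<close> and \<open>g\<close> lies in
  the common stabilizer. The two actions may live on different types, so elements of a poset can be
  compared with sets of points.\<close>

lemma action_eq_iff_of_stabilizer_eq:
  assumes "group_action G E \<alpha>" "group_action G F \<beta>" "x \<in> E" "y \<in> F"
    and "stabilizer G \<alpha> x = stabilizer G \<beta> y"
    and "g \<in> carrier G" "h \<in> carrier G"
  shows "\<alpha> g x = \<alpha> h x \<longleftrightarrow> \<beta> g y = \<beta> h y"
  using assms by (simp add: group_action.action_eq_iff_stabilizer)

text \<open>\<open>poset_isomorphic\<close> also asks that both relations be partial orders. For the
  relation on pairs this is transported from \<open>T\<close> along the bijection; injectivity of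
  \<open>f\<close> gives antisymmetry.\<close>

lemma partial_order_on_pullback:
  assumes r: "partial_order_on B r" and f: "bij_betw f A B" and s: "s \<subseteq> A \<times> A"
    and iff: "\<And>x y. x \<in> A \<Longrightarrow> y \<in> A \<Longrightarrow> (x, y) \<in> s \<longleftrightarrow> (f x, f y) \<in> r"
  shows "partial_order_on A s"
proof -
  have fB: "f x \<in> B" if "x \<in> A" for x using f that by (rule bij_betwE[rule_format])
  have rr: "refl_on B r" "trans r" "antisym r"
    using r by (auto simp: partial_order_on_def preorder_on_def)
  have "refl_on A s" using rr(1) iff fB s by (auto simp: refl_on_def)
  moreover have "trans s"
  proof (rule transI)
    fix x y z assume xy: "(x, y) \<in> s" and yz: "(y, z) \<in> s"
    then have A: "x \<in> A" "y \<in> A" "z \<in> A" using s by auto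
    then have "(f x, f z) \<in> r" using xy yz iff rr(2) by (meson transD)
    then show "(x, z) \<in> s" using iff A by blast
  qed
  moreover have "antisym s"
  proof (rule antisymI)
    fix x y assume xy: "(x, y) \<in> s" and yx: "(y, x) \<in> s"
    then have A: "x \<in> A" "y \<in> A" using s by auto
    then have "f x = f y" using xy yx iff rr(3) by (meson antisymD)
    then show "x = y" using f A by (auto simp: bij_betw_def inj_on_def)
  qed
  ultimately show ?thesis using s by (auto simp: partial_order_on_def preorder_on_def)
qed

text \<open>The group inverse of \<open>g\<close> is a two-sided inverse for composition, so taking
  images under it undoes taking images under \<open>g\<close>.\<close>

lemma group_action_image:
  assumes "group G" and mult: "mult G = (\<circ>)" and one: "\<one>\<^bsub>G\<^esub> = id"
  shows "group_action G UNIV (image :: ('w \<Rightarrow> 'w) \<Rightarrow> 'w set \<Rightarrow> 'w set)"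
proof -
  interpret group G by fact
  have "image g \<in> Bij (UNIV :: 'w set set)" if "g \<in> carrier G" for g
  proof -
    have "inv\<^bsub>G\<^esub> g \<circ> g = id" "g \<circ> inv\<^bsub>G\<^esub> g = id"
      using that l_inv r_inv mult one by auto
    then have "image (inv\<^bsub>G\<^esub> g) \<circ> image g = id" "image g \<circ> image (inv\<^bsub>G\<^esub> g) = id"
      by (simp_all add: fun_eq_iff image_image)
    then have "bij (image g)" by (rule o_bij)
    then show ?thesis by (simp add: Bij_def)
  qed
  then have "image \<in> hom G (BijGroup (UNIV :: 'w set set))"
    by (auto simp: hom_def BijGroup_def mult compose_def image_comp)
  then show ?thesis
    by (simp add: group_action_def group_hom_def group_hom_axioms_def group_BijGroup is_group)
qed

lemma mem_face_poset_order_iff: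
  "((z1, \<eta>1), (z2, \<eta>2)) \<in> face_poset_order G r Z lam \<longleftrightarrow>
    (z1, \<eta>1) \<in> face_poset_carrier G Z lam \<and> (z2, \<eta>2) \<in> face_poset_carrier G Z lam \<and>
    (z1, z2) \<in> r \<and>
    (\<exists>g\<in>carrier G. (inv\<^bsub>G\<^esub> g) ` \<eta>1 = lam z1 \<and> (inv\<^bsub>G\<^esub> g) ` \<eta>2 = lam z2)"
  unfolding face_poset_order_def by simp

text \<open>Here \<open>G\<close> is any group of maps under composition, acting on faces by images;
  the reflection group is an instance.\<close>

lemma poset_isomorphic_face_poset:
  fixes G :: "('w::real_vector \<Rightarrow> 'w) monoid"
  assumes mult: "mult G = (\<circ>)" and one: "\<one>\<^bsub>G\<^esub> = id"
    and sym: "symmetric_poset G T r \<alpha>"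
    and gen: "generating_subposet G T r \<alpha> Z"
    and stab: "stabilizer_preserving G \<Phi> \<alpha> Z lam"
  shows "poset_isomorphic (face_poset_carrier G Z lam) (face_poset_order G r Z lam) T r"
proof -
  let ?C = "face_poset_carrier G Z lam" and ?R = "face_poset_order G r Z lam"
  have po: "partial_order_on T r" and act: "group_action G T \<alpha>"
    using sym by (auto simp: symmetric_poset_def)
  interpret group_action G T \<alpha> by (rule act)
  \<comment> \<open>The group axioms for \<open>G\<close> come with its action on \<open>T\<close>,
    since a \<open>group_action\<close> is a group homomorphism from \<open>G\<close>.\<close>
  interpret group G using group_hom group_hom.axioms(1) by blast
  have img: "group_action G UNIV (image :: ('w \<Rightarrow> 'w) \<Rightarrow> 'w set \<Rightarrow> 'w set)"
    by (rule group_action_image[OF is_group mult one])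
  have ZT: "Z \<subseteq> T" and Tdef: "T = (\<Union>z\<in>Z. orbit G \<alpha> z)"
    and disj: "disjoint_family_on (orbit G \<alpha>) Z"
    and ord: "\<And>g1 g2 z1 z2. \<lbrakk>g1 \<in> carrier G; g2 \<in> carrier G; z1 \<in> Z; z2 \<in> Z\<rbrakk> \<Longrightarrow>
        (\<alpha> g1 z1, \<alpha> g2 z2) \<in> r \<longleftrightarrow>
          (z1, z2) \<in> r \<and> (\<exists>g\<in>carrier G. \<alpha> g1 z1 = \<alpha> g z1 \<and> \<alpha> g2 z2 = \<alpha> g z2)"
    using gen unfolding generating_subposet_def by blast+
  have same: "\<alpha> g z = \<alpha> h z \<longleftrightarrow> g ` lam z = h ` lam z"
    if "z \<in> Z" "g \<in> carrier G" "h \<in> carrier G" for z g h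
    by (rule action_eq_iff_of_stabilizer_eq[OF act img])
      (use that ZT stab in \<open>auto simp: stabilizer_preserving_def\<close>)
  \<comment> \<open>This moves \<open>g\<close> to the other side, bringing the order on pairs
    closer to condition (2) for \<open>Z\<close>.\<close>
  have inv_image: "(inv\<^bsub>G\<^esub> g) ` X = Y \<longleftrightarrow> X = g ` Y" if "g \<in> carrier G" for g X Y
    using group_action.orbit_sym_aux[OF img that, of Y X]
      group_action.orbit_sym_aux[OF img inv_closed[OF that], of X Y] that by auto
  define f where "f p = \<alpha> (SOME g. g \<in> carrier G \<and> snd p = g ` lam (fst p)) (fst p)" for p
  have f: "f (z, g ` lam z) = \<alpha> g z" if z: "z \<in> Z" and g: "g \<in> carrier G" for z g
  proof -
    let ?h = "SOME h. h \<in> carrier G \<and> g ` lam z = h ` lam z"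
    have "?h \<in> carrier G \<and> g ` lam z = ?h ` lam z"
      by (rule someI[of _ g]) (simp add: g)
    then have "\<alpha> ?h z = \<alpha> g z" using same z g by auto
    then show ?thesis by (simp add: f_def)
  qed
  have "inj_on f ?C"
  proof (rule inj_onI)
    fix p q assume "p \<in> ?C" "q \<in> ?C" and eq: "f p = f q"
    then obtain z1 g1 z2 g2 where p: "p = (z1, g1 ` lam z1)" "z1 \<in> Z" "g1 \<in> carrier G"
      and q: "q = (z2, g2 ` lam z2)" "z2 \<in> Z" "g2 \<in> carrier G"
      by (auto simp: face_poset_carrier_def)
    have e: "\<alpha> g1 z1 = \<alpha> g2 z2" using eq f[OF p(2,3)] f[OF q(2,3)] p(1) q(1) by simp
    \<comment> \<open>A common value lies in both orbits, and disjointness then forces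
      \<open>z1 = z2\<close>. Only after that does \<open>same\<close>, which concerns a single
      \<open>z\<close>, apply.\<close>
    have "\<alpha> g1 z1 \<in> orbit G \<alpha> z1" "\<alpha> g2 z2 \<in> orbit G \<alpha> z2"
      using p q by (auto simp: orbit_def)
    then have "\<alpha> g1 z1 \<in> orbit G \<alpha> z1 \<inter> orbit G \<alpha> z2" using e by simp
    then have z: "z1 = z2" using disj p(2) q(2) by (auto simp: disjoint_family_on_def)
    then have "g1 ` lam z1 = g2 ` lam z1" using e same[of z1 g1 g2] p(2,3) q(3) by simp
    then show "p = q" using p(1) q(1) z by simp
  qed
  moreover have "f ` ?C = T"
  proof -
    \<comment> \<open>Split the pairs by first component: \<open>f\<close> sends the part over
      \<open>z\<close> onto the orbit of \<open>z\<close>, and these orbits cover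
      \<open>T\<close>.\<close>
    have "?C = (\<Union>z\<in>Z. (\<lambda>g. (z, g ` lam z)) ` carrier G)"
      by (auto simp: face_poset_carrier_def)
    then have "f ` ?C = (\<Union>z\<in>Z. (\<lambda>g. \<alpha> g z) ` carrier G)"
      using f by (simp add: image_UN image_image)
    also have "\<dots> = (\<Union>z\<in>Z. orbit G \<alpha> z)" by (auto simp: orbit_def)
    finally show ?thesis unfolding Tdef[symmetric] .
  qed
  ultimately have bij: "bij_betw f ?C T" by (simp add: bij_betw_def)
  have iff: "(p, q) \<in> ?R \<longleftrightarrow> (f p, f q) \<in> r" if C: "p \<in> ?C" "q \<in> ?C" for p q
  proof -
    obtain z1 g1 z2 g2 where p: "p = (z1, g1 ` lam z1)" "z1 \<in> Z" "g1 \<in> carrier G"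
      and q: "q = (z2, g2 ` lam z2)" "z2 \<in> Z" "g2 \<in> carrier G"
      using C by (auto simp: face_poset_carrier_def)
    have "(p, q) \<in> ?R \<longleftrightarrow> (z1, z2) \<in> r \<and>
        (\<exists>g\<in>carrier G. (inv\<^bsub>G\<^esub> g) ` (g1 ` lam z1) = lam z1 \<and> (inv\<^bsub>G\<^esub> g) ` (g2 ` lam z2) = lam z2)"
      using C unfolding p(1) q(1) by (simp only: mem_face_poset_order_iff simp_thms)
    \<comment> \<open>The same witness \<open>g\<close> serves on both sides: each conjunct becomes
      \<open>gi\<close> lam zi = g \<open>lam zi\<close> by \<open>inv_image\<close>, and then an
      equation in \<open>T\<close> by \<open>same\<close>.\<close>
    also have "\<dots> \<longleftrightarrow> (z1, z2) \<in> r \<and>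
        (\<exists>g\<in>carrier G. \<alpha> g1 z1 = \<alpha> g z1 \<and> \<alpha> g2 z2 = \<alpha> g z2)"
      by (intro conj_cong bex_cong refl) (simp_all add: inv_image same p(2,3) q(2,3))
    also have "\<dots> \<longleftrightarrow> (f p, f q) \<in> r"
      using ord[OF p(3) q(3) p(2) q(2)] f[OF p(2,3)] f[OF q(2,3)] p(1) q(1)
      by simp
    finally show ?thesis .
  qed
  have "?R \<subseteq> ?C \<times> ?C" unfolding face_poset_order_def by blast
  then have "partial_order_on ?C ?R" by (rule partial_order_on_pullback[OF po bij _ iff])
  then show ?thesis using po bij iff by (auto simp only: poset_isomorphic_def)
qed

theorem theorem6p6:
  fixes H :: "'w::real_inner set set"
    and \<Phi> :: "'w set"
    and T Z :: "'t set"
    and r :: "('t \<times> 't) set"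
    and \<alpha> :: "('w \<Rightarrow> 'w) \<Rightarrow> 't \<Rightarrow> 't"
    and lam :: "'t \<Rightarrow> 'w set"
    and G :: "('w \<Rightarrow> 'w) monoid"
  assumes "G = reflection_group H"
    and "\<exists>B. finite B \<and> span B = (UNIV :: 'w set)"
    and "finite H"
    and "\<forall>h\<in>H. linear_hyperplane h"
    and "\<exists>p. \<Inter>H = {p}"
    and "finite (carrier G)"
    and "chamber H \<Phi>"
    and "symmetric_poset G T r \<alpha>"
    and "generating_subposet G T r \<alpha> Z"
    and "compatible G \<Phi> \<alpha> Z"
    and "stabilizer_preserving G \<Phi> \<alpha> Z lam"
  shows "poset_isomorphic (face_poset_carrier G Z lam) (face_poset_order G r Z lam) T r"
proof (rule poset_isomorphic_face_poset[OF _ _ assms(8,9,11)])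
  \<comment> \<open>The reflection group changes only the carrier of \<open>GL\<close>, so it keeps
    composition and the identity map.\<close>
  show "mult G = (\<circ>)" "\<one>\<^bsub>G\<^esub> = id"
    using assms(1) by (simp_all add: reflection_group_def GL_def)
qed

end
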